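(* One has the strict inclusion of classes of functions $$\mathcal{C}o([0,\infty))\subsetneqq \mathcal{D}_0([0,\infty)).$$
   Context: A function $f:[0,\infty)\to\mathbb{R}$ is called normalised if $f(1)=0$. $\mathcal{C}o([0,\infty))$ is the class of all normalised measurable functions $f:[0,\infty)\to\mathbb{R}$ that are continuous and convex on $[0,\infty)$. $\mathcal{D}_0([0,\infty))$ is the class of all normalised measurable functions $f:[0,\infty)\to\mathbb{R}$ for which there is a monotonic nondecreasing function $g:[0,\infty)\to\mathbb{R}$ with $f(t)=(t-1)g(t)$ for all $t\in[0,\infty)$. *)

theory Defs
  imports "HOL-Analysis.Analysis"
begin

text \<open>
  A function on \<open>[0,\<infinity>)\<close> is represented by its extensional extension to \<^typ>\<open>real\<close>
  (value \<^const>\<open>undefined\<close> on negative arguments), so that equality of representatives is equality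
  of functions on \<open>[0,\<infinity>)\<close>. Measurability is Borel measurability.
\<close>

definition normalised :: "(real \<Rightarrow> real) \<Rightarrow> bool" where
  "normalised f \<longleftrightarrow> f 1 = 0"

definition normalised_measurable :: "(real \<Rightarrow> real) set" where
  "normalised_measurable =
     {f \<in> {0..} \<rightarrow>\<^sub>E UNIV. normalised f \<and> f \<in> borel_measurable (restrict_space borel {0..})}"

definition Co_class :: "(real \<Rightarrow> real) set" where
  "Co_class = {f \<in> normalised_measurable. continuous_on {0..} f \<and> convex_on {0..} f}"

text \<open>
  Only the values of the witness \<open>g\<close> on \<open>[0,\<infinity>)\<close> are constrained.
\<close>

definition D0_class :: "(real \<Rightarrow> real) set" where
  "D0_class = {f \<in> normalised_measurable.
     \<exists>g :: real \<Rightarrow> real. mono_on {0..} g \<and> (\<forall>t\<in>{0..}. f t = (t - 1) * g t)}"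

end

theory Submission imports Defs
begin

text \<open>
  For convex \<open>f\<close> with \<open>f 1 = 0\<close>, the quotient \<open>f t / (t - 1)\<close> is the slope of the chord of \<open>f\<close> between \<open>1\<close>
  and \<open>t\<close>, which is nondecreasing in \<open>t\<close>; at \<open>t = 1\<close> it is extended by the right derivative. The function
  \<open>(t - 1) * min t 2\<close> has a concave kink at \<open>2\<close>, so the inclusion is strict.
\<close>

lemma convex_on_slope_mono:
  fixes f :: "real \<Rightarrow> real"
  assumes f: "convex_on A f" and A: "s \<in> A" "t \<in> A" "c \<in> A"
    and "s \<le> t" "s \<noteq> c" "t \<noteq> c"
  shows "(f s - f c) / (s - c) \<le> (f t - f c) / (t - c)"
proof -
  have swap: "(f c - f x) / (c - x) = (f x - f c) / (x - c)" for x
    by (metis minus_diff_eq minus_divide_divide)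
  consider "s = t" | "s < t" "t < c" | "s < c" "c < t" | "c < s" "s < t"
    using assms by linarith
  then show ?thesis
  proof cases
    case 2
    then show ?thesis
      using convex_on_slope_le(2)[OF f, of s c t] A by simp
  next
    case 3
    \<comment> \<open>Both slopes are compared with that of the chord from \<open>s\<close> to
      \<open>t\<close>, which spans \<open>c\<close>.\<close>
    then show ?thesis
      using convex_on_slope_le[OF f, of s t c] A swap[of t] by linarith
  next
    case 4
    then show ?thesis
      using convex_on_slope_le(1)[OF f, of c t s] A by (simp add: swap)
  qed simp
qed

text \<open>Every value of \<open>q\<close> left of \<open>c\<close> is a lower bound for the values
  right of \<open>c\<close>, so their infimum fits in between. The point \<open>l\<close> supplies
  boundedness below and \<open>u\<close> nonemptiness, so that \<open>Inf\<close> is a genuine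
  infimum.\<close>

lemma mono_on_insert_Inf:
  fixes q :: "real \<Rightarrow> real"
  assumes mono: "mono_on (A - {c}) q" and l: "l \<in> A" "l < c" and u: "u \<in> A" "c < u"
  shows "mono_on A (q(c := Inf (q ` (A \<inter> {c<..}))))"
proof (rule mono_onI)
  fix s t assume st: "s \<in> A" "t \<in> A" "s \<le> t"
  let ?R = "q ` (A \<inter> {c<..})"
  have lower: "q s \<le> r" if "r \<in> ?R" "s \<in> A" "s < c" for r s
    using that by (auto intro!: mono_onD[OF mono])
  have "bdd_below ?R"
    using lower l by (intro bdd_belowI[of _ "q l"]) auto
  then have Inf_le: "Inf ?R \<le> q t" if "t \<in> A" "c < t" for t
    using that by (intro cInf_lower) auto
  have le_Inf: "q s \<le> Inf ?R" if "s \<in> A" "s < c" for s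
    using that lower u by (intro cInf_greatest) auto
  show "(q(c := Inf ?R)) s \<le> (q(c := Inf ?R)) t"
    using st Inf_le le_Inf mono_onD[OF mono, of s t] by (cases "s = c"; cases "t = c") auto
qed

lemma Co_class_subset_D0_class: "Co_class \<subseteq> D0_class"
proof
  fix f assume f: "f \<in> Co_class"
  then have convex: "convex_on {0..} f" and f1: "f 1 = 0"
    by (auto simp: Co_class_def normalised_measurable_def normalised_def)
  define q where "q t = f t / (t - 1)" for t
  \<comment> \<open>Division by zero makes \<open>q 1 = 0\<close>, which can break monotonicity, so
    this value is replaced.\<close>
  define g where "g = q(1 := Inf (q ` ({0..} \<inter> {1<..})))"
  have "mono_on ({0..} - {1}) q"
    using convex_on_slope_mono[OF convex, where c = 1] f1
    by (intro mono_onI) (simp add: q_def)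
  then have "mono_on {0..} g"
    unfolding g_def by (rule mono_on_insert_Inf[of _ _ _ 0 2]) auto
  \<comment> \<open>At \<open>t = 1\<close> both sides vanish, whatever \<open>g 1\<close>
    is.\<close>
  moreover have "\<forall>t\<in>{0..}. f t = (t - 1) * g t"
    by (auto simp: g_def q_def f1)
  ultimately show "f \<in> D0_class"
    using f by (auto simp: Co_class_def D0_class_def)
qed

lemma kink_in_D0_class: "(\<lambda>t\<in>{0..}. (t - 1) * min t 2) \<in> D0_class" (is "?f \<in> _")
proof -
  have "(\<lambda>t::real. (t - 1) * min t 2) \<in> borel_measurable (restrict_space borel {0..})"
    by (intro measurable_restrict_space1) measurable
  then have "?f \<in> borel_measurable (restrict_space borel {0..})"
    by (subst measurable_cong[where g = "\<lambda>t. (t - 1) * min t 2"]) (auto simp: space_restrict_space)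
  then have "?f \<in> normalised_measurable"
    by (auto simp: normalised_measurable_def normalised_def)
  moreover have "mono_on {0..} (\<lambda>t::real. min t 2)"
    by (auto intro!: mono_onI)
  ultimately show ?thesis
    unfolding D0_class_def by fastforce
qed

lemma kink_not_in_Co_class: "(\<lambda>t\<in>{0..}. (t - 1) * min t 2) \<notin> Co_class" (is "?f \<notin> _")
proof
  assume "?f \<in> Co_class"
  then have "convex_on {0..} ?f"
    by (simp add: Co_class_def)
  \<comment> \<open>The midpoint is the kink 2, where the value is 2, but the endpoint values 3/4
    and 3 average only 15/8.\<close>
  from convex_onD[OF this, of "1/2" "3/2" "5/2"] show False
    by simp
qed

theorem lemma1: "Co_class \<subset> D0_class"
  using Co_class_subset_D0_class kink_in_D0_class kink_not_in_Co_class by blast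

end
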